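(* Let $G$ be a connected graph and $v\in V(G)$, with $\alpha=\alpha_{G}(v)$ the accessibility index of $v$ in $G$ and $m=|E(G)|\ge 1$. Let $H$ be the graph obtained by attaching the center of a spider graph $S_{2,3}$ to $G$ at $v$ (that is, the center of $S_{2,3}$ is identified with $v$). Then $H$ will have a Braess $K_3$ containing no Braess edges if and only if \[3m^2+93m+360<6m\alpha<4m^2+94m+330.\]
   Context: Graphs are finite, simple and undirected. The spider graph $S_{2,3}$ is the tree on $7$ vertices consisting of a center vertex of degree $3$ with three legs (paths) of length $2$ attached, so that each of the three pendent vertices is at distance $2$ from the center. For a connected graph $G$ with at least one edge, the random walk on $G$ has transition matrix $D^{-1}A$ ($A$ the adjacency matrix, $D$ the diagonal matrix of degrees), with stationary distribution $w_i=\deg(v_i)/(2|E(G)|)$ and mean first passage times $m_{i,j}$ ($i\ne j$; the expected number of steps to first reach $v_j$ from $v_i$). The accessibility index of $v_j$ is $\alpha_G(v_j)=\sum_{i\ne j}w_im_{i,j}$. Kemeny's constant is $\mathcal{K}(G)=\sum_{j\neq i} w_j m_{i,j}$, which is independent of $i$. A Braess $K_3$ of a connected graph $H$ is an independent set of three vertices of $H$ such that the graph $\widetilde{H}$ obtained by adding all three edges between them satisfies $\mathcal{K}(\widetilde{H})>\mathcal{K}(H)$. A Braess edge of $H$ is a non-edge of $H$ whose addition gives a graph $\widehat{H}$ with $\mathcal{K}(\widehat{H})\ge\mathcal{K}(H)$. A Braess $K_3$ contains no Braess edges if none of the three pairs of its vertices is a Braess edge of $H$.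
   Formalization: The equivalence is stated for the Braess K_3 formed by the three spider vertices adjacent to v; with "some Braess K_3 anywhere in H" the "only if" direction is false (e.g. G a path 0–…–7 with a spider attached at 6, v = 5). *)

theory Defs
  imports "HOL-Probability.Probability_Mass_Function" "Graph_Theory.Graph_Theory"
begin

text \<open>
  A finite simple undirected graph is a \<^locale>\<open>pair_graph\<close>: every edge is represented by its
  two arcs. Hence \<^const>\<open>out_degree\<close> is the degree, and edges are counted as unordered pairs.
\<close>

definition num_edges :: "'a pair_pre_digraph \<Rightarrow> nat" where
  "num_edges G = card ((\<lambda>(x, y). {x, y}) ` parcs G)"

definition walk_step :: "'a pair_pre_digraph \<Rightarrow> 'a \<Rightarrow> 'a pmf" where
  "walk_step G u = pmf_of_set (parcs G `` {u})"

text \<open>The transition matrix of \<^const>\<open>walk_step\<close> is $D^{-1}A$.\<close>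

lemma pmf_walk_step:
  assumes "pair_graph G" and "parcs G `` {u} \<noteq> {}"
  shows "pmf (walk_step G u) w =
    (if (u, w) \<in> parcs G then 1 / real (out_degree (with_proj G) u) else 0)"
proof -
  interpret pair_graph G by fact
  have fin: "finite (parcs G `` {u})"
    using pair_finite_arcs by (rule finite_Image)
  have "out_arcs (with_proj G) u = Pair u ` (parcs G `` {u})"
    by (auto simp: out_arcs_def)
  then have "out_degree (with_proj G) u = card (parcs G `` {u})"
    by (simp add: out_degree_def card_image inj_on_def)
  then show ?thesis
    using assms(2) fin by (simp add: walk_step_def pmf_of_set indicator_def)
qed

text \<open>The law of the list of the vertices visited at times \<open>0, \<dots>, n\<close> by the walk started at \<open>u\<close>.\<close>

primrec walk :: "'a pair_pre_digraph \<Rightarrow> nat \<Rightarrow> 'a \<Rightarrow> 'a list pmf" where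
  "walk G 0 u = return_pmf [u]"
| "walk G (Suc n) u = bind_pmf (walk_step G u) (\<lambda>w. map_pmf ((#) u) (walk G n w))"

definition first_passage_prob :: "'a pair_pre_digraph \<Rightarrow> 'a \<Rightarrow> 'a \<Rightarrow> nat \<Rightarrow> real" where
  "first_passage_prob G u w n =
    measure_pmf.prob (walk G n u) {xs. xs ! n = w \<and> (\<forall>k<n. xs ! k \<noteq> w)}"

text \<open>
  The expectation of the first passage time, whose law is \<^term>\<open>first_passage_prob G u w\<close>.
  On a finite connected graph this time is almost surely finite and the series converges.
\<close>

definition mean_first_passage :: "'a pair_pre_digraph \<Rightarrow> 'a \<Rightarrow> 'a \<Rightarrow> real" where
  "mean_first_passage G u w = (\<Sum>n. real n * first_passage_prob G u w n)"

definition stationary :: "'a pair_pre_digraph \<Rightarrow> 'a \<Rightarrow> real" where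
  "stationary G u = real (out_degree (with_proj G) u) / (2 * real (num_edges G))"

definition accessibility_index :: "'a pair_pre_digraph \<Rightarrow> 'a \<Rightarrow> real" where
  "accessibility_index G v =
    (\<Sum>u\<in>pverts G - {v}. stationary G u * mean_first_passage G u v)"

text \<open>On a connected graph with an edge, the sum below does not depend on the start vertex \<open>u\<close>.\<close>

definition kemeny :: "'a pair_pre_digraph \<Rightarrow> real" where
  "kemeny G = (THE k. \<forall>u\<in>pverts G.
    (\<Sum>w\<in>pverts G - {u}. stationary G w * mean_first_passage G u w) = k)"

definition add_edges :: "'a pair_pre_digraph \<Rightarrow> ('a \<times> 'a) set \<Rightarrow> 'a pair_pre_digraph" where
  "add_edges G F = \<lparr>pverts = pverts G, parcs = parcs G \<union> F \<union> F\<inverse>\<rparr>"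

definition braess_K3 :: "'a pair_pre_digraph \<Rightarrow> 'a set \<Rightarrow> bool" where
  "braess_K3 H T \<longleftrightarrow> T \<subseteq> pverts H \<and> card T = 3 \<and> (\<forall>x\<in>T. \<forall>y\<in>T. (x, y) \<notin> parcs H) \<and>
    kemeny (add_edges H {(x, y). x \<in> T \<and> y \<in> T \<and> x \<noteq> y}) > kemeny H"

definition braess_edge :: "'a pair_pre_digraph \<Rightarrow> 'a \<Rightarrow> 'a \<Rightarrow> bool" where
  "braess_edge H x y \<longleftrightarrow> x \<in> pverts H \<and> y \<in> pverts H \<and> x \<noteq> y \<and> (x, y) \<notin> parcs H \<and>
    kemeny (add_edges H {(x, y)}) \<ge> kemeny H"

definition braess_K3_without_braess_edges :: "'a pair_pre_digraph \<Rightarrow> 'a set \<Rightarrow> bool" where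
  "braess_K3_without_braess_edges H T \<longleftrightarrow>
    braess_K3 H T \<and> (\<forall>x\<in>T. \<forall>y\<in>T. \<not> braess_edge H x y)"

text \<open>The spider $S_{2,3}$ with center \<open>c\<close> and legs \<open>c - a\<^sub>i - b\<^sub>i\<close>, its seven vertices being distinct.\<close>

definition spider23 ::
  "'a \<Rightarrow> 'a \<Rightarrow> 'a \<Rightarrow> 'a \<Rightarrow> 'a \<Rightarrow> 'a \<Rightarrow> 'a \<Rightarrow> 'a pair_pre_digraph" where
  "spider23 c a1 b1 a2 b2 a3 b3 =
    add_edges \<lparr>pverts = {c, a1, b1, a2, b2, a3, b3}, parcs = {}\<rparr>
      {(c, a1), (a1, b1), (c, a2), (a2, b2), (c, a3), (a3, b3)}"

text \<open>
  If two graphs have exactly one common vertex, their union is the graph obtained from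
  disjoint copies by identifying the two copies of that vertex.
\<close>

definition graph_union :: "'a pair_pre_digraph \<Rightarrow> 'a pair_pre_digraph \<Rightarrow> 'a pair_pre_digraph" where
  "graph_union G S = \<lparr>pverts = pverts G \<union> pverts S, parcs = parcs G \<union> parcs S\<rparr>"

end

theory Submission
  imports Defs
begin

text \<open>
  Mean first passage times to \<open>w\<close> are the unique solution of \<open>h w = 0\<close>, \<open>h = 1 + D\<^sup>-\<^sup>1 A h\<close> off \<open>w\<close>, so
  a solution that can be guessed need only be checked. If \<open>G\<close> and \<open>S\<close> share exactly the vertex
  \<open>v\<close>, the solutions on the union can be written in terms of those on the parts. Summing up gives,
  with \<open>m\<^sub>G, m\<^sub>S\<close> the numbers of edges,
  \<open>K(G \<union> S) = K(G) + K(S) + (m\<^sub>S \<alpha>\<^sub>G(v) + m\<^sub>G \<alpha>\<^sub>S(v)) / (m\<^sub>G + m\<^sub>S)\<close>.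
  Adding edges among the legs changes only \<open>S\<close>, so \<open>K(G)\<close> cancels from every comparison, and it
  remains to insert the parameters \<open>(m\<^sub>S, K(S), \<alpha>\<^sub>S)\<close>: they are \<open>(6, 19/2, 5/2)\<close> for the spider,
  \<open>(7, 172/21, 22/7)\<close> with one edge added and \<open>(9, 37/6, 13/3)\<close> with the triangle added.
\<close>

section \<open>Mean first passage times and Kemeny's constant\<close>

abbreviation nbrs :: "'a pair_pre_digraph \<Rightarrow> 'a \<Rightarrow> 'a set" where
  "nbrs G u \<equiv> parcs G `` {u}"

text \<open>Counting \<open>nbrs G u\<close> lets a constant summed over neighbours become a
  multiple of \<open>deg G u\<close>; \<open>out_degree_eq_deg\<close> ties it to the degree in
  \<open>stationary\<close>.\<close>

definition deg :: "'a pair_pre_digraph \<Rightarrow> 'a \<Rightarrow> real" where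
  "deg G u = real (card (nbrs G u))"

text \<open>The arc count is both the sum of the degrees and twice the number of edges, that is, the
  denominator of the stationary distribution.\<close>

definition vol :: "'a pair_pre_digraph \<Rightarrow> real" where
  "vol G = real (card (parcs G))"

text \<open>The equation \<open>h = 1 + D\<^sup>-\<^sup>1 A h\<close> off \<open>w\<close>, multiplied by the degree.\<close>

definition hitting :: "'a pair_pre_digraph \<Rightarrow> 'a \<Rightarrow> ('a \<Rightarrow> real) \<Rightarrow> bool" where
  "hitting G w h \<longleftrightarrow> h w = 0 \<and> (\<forall>u\<in>pverts G - {w}. (\<Sum>x\<in>nbrs G u. h u - h x) = deg G u)"

lemma hittingD:
  "hitting G w h \<Longrightarrow> h w = 0"
  "hitting G w h \<Longrightarrow> u \<in> pverts G \<Longrightarrow> u \<noteq> w \<Longrightarrow> (\<Sum>x\<in>nbrs G u. h u - h x) = deg G u"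
  by (auto simp: hitting_def)

lemma out_degree_eq_deg: "real (out_degree (with_proj G) u) = deg G u"
proof -
  have "out_arcs (with_proj G) u = Pair u ` nbrs G u"
    by (auto simp: out_arcs_def)
  then show ?thesis
    by (simp add: out_degree_def deg_def card_image inj_on_def)
qed

section \<open>First-step recurrence for the first passage law\<close>

lemma measure_bind_pmf_eq_expectation:
  "measure_pmf.prob (bind_pmf p f) X = measure_pmf.expectation p (\<lambda>x. measure_pmf.prob (f x) X)"
  unfolding measure_pmf_bind
  by (rule measure_pmf.measure_bind[where N = "count_space UNIV"]) (auto intro: measure_pmf_in_subprob_space)

lemma first_passage_prob_0: "first_passage_prob G u w 0 = (if u = w then 1 else 0)"
  by (simp add: first_passage_prob_def indicator_def)

lemma first_passage_prob_self_Suc: "first_passage_prob G w w (Suc n) = 0"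
proof -
  have "xs ! 0 = w" if "xs \<in> set_pmf (walk G (Suc n) w)" for xs
    using that by auto
  then have "set_pmf (walk G (Suc n) w) \<inter> {xs. xs ! Suc n = w \<and> (\<forall>k<Suc n. xs ! k \<noteq> w)} = {}"
    by blast
  then show ?thesis
    unfolding first_passage_prob_def measure_pmf_zero_iff by blast
qed

text \<open>All mass sits at time 0, which has weight 0. This is the boundary value of the hitting
  equation and allows sums over \<open>pverts G - {u}\<close> to be extended to all of
  \<open>pverts G\<close>.\<close>

lemma mean_first_passage_self: "mean_first_passage G w w = 0"
proof -
  have "real n * first_passage_prob G w w n = 0" for n
    by (cases n) (auto simp: first_passage_prob_self_Suc)
  then show ?thesis by (simp only: mean_first_passage_def suminf_zero)
qed

text \<open>Condition on the first step. Since \<open>u \<noteq> w\<close>, time 0 is no visit to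
  \<open>w\<close>, so the event for \<open>u # xs\<close> is the event for \<open>xs\<close>
  shifted by one.\<close>

lemma first_passage_prob_Suc:
  assumes "u \<noteq> w" and "finite (nbrs G u)" and "nbrs G u \<noteq> {}"
  shows "first_passage_prob G u w (Suc n) = (\<Sum>x\<in>nbrs G u. first_passage_prob G x w n) / deg G u"
proof -
  have *: "{xs. xs ! n = w \<and> (\<forall>k<Suc n. (u # xs) ! k \<noteq> w)} =
    {xs. xs ! n = w \<and> (\<forall>k<n. xs ! k \<noteq> w)}"
    using assms(1) by (auto simp: less_Suc_eq_0_disj)
  show ?thesis
    using assms
    by (simp add: first_passage_prob_def measure_bind_pmf_eq_expectation * walk_step_def
        integral_pmf_of_set deg_def)
qed

text \<open>Connected graphs with an edge: no vertex is isolated, so \<open>walk_step\<close> is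
  always uniform on a nonempty set. \<open>reach\<close> is stated with \<open>rtrancl\<close> to
  allow induction along paths.\<close>

locale walk_graph = pair_graph G for G :: "'a pair_pre_digraph" +
  assumes reach: "u \<in> pverts G \<Longrightarrow> w \<in> pverts G \<Longrightarrow> (u, w) \<in> (parcs G)\<^sup>*"
    and arcs_ne: "parcs G \<noteq> {}"
begin

section \<open>Degrees and volume\<close>

lemma nbrs_subset: "nbrs G u \<subseteq> pverts G"
  using in_arcsD2 by auto

lemma finite_nbrs: "finite (nbrs G u)"
  using nbrs_subset pair_finite_verts by (rule finite_subset)

text \<open>A path from \<open>u\<close> to the tail of some arc either has a first arc, which
  leaves \<open>u\<close>, or is trivial, and then \<open>u\<close> is that tail.\<close>

lemma nbrs_ne:
  assumes "u \<in> pverts G"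
  shows "nbrs G u \<noteq> {}"
proof -
  obtain x y where xy: "(x, y) \<in> parcs G" using arcs_ne by auto
  show ?thesis
  proof (cases "u = x")
    case False
    have "(u, x) \<in> (parcs G)\<^sup>*" using reach assms in_arcsD1[OF xy] by blast
    then show ?thesis using False by (auto elim: converse_rtranclE)
  qed (use xy in auto)
qed

lemma deg_pos: "u \<in> pverts G \<Longrightarrow> deg G u > 0"
  using nbrs_ne finite_nbrs by (simp add: deg_def card_gt_0_iff)

lemma vol_pos: "vol G > 0"
  using arcs_ne pair_finite_arcs by (simp add: vol_def card_gt_0_iff)

lemma vol_eq_sum_deg: "vol G = (\<Sum>u\<in>pverts G. deg G u)"
proof -
  have "parcs G = (SIGMA u: pverts G. nbrs G u)"
    using in_arcsD1 by auto
  then have "card (parcs G) = card (SIGMA u: pverts G. nbrs G u)" by simp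
  also have "\<dots> = (\<Sum>u\<in>pverts G. card (nbrs G u))"
    using pair_finite_verts finite_nbrs by (intro card_SigmaI) auto
  finally show ?thesis by (simp add: vol_def deg_def)
qed

text \<open>Every fibre of the map from arcs to edges consists of two opposite arcs, distinct
  because there are no loops.\<close>

lemma vol_eq_num_edges: "vol G = 2 * real (num_edges G)"
proof -
  let ?f = "\<lambda>(x, y). {x, y}"
  have "card (parcs G) = (\<Sum>e\<in>?f ` parcs G. card {p \<in> parcs G. ?f p = e})"
    using sum.image_gen[OF pair_finite_arcs, of "\<lambda>_. 1 :: nat" ?f] by (simp only: card_eq_sum)
  also have "\<dots> = (\<Sum>e\<in>?f ` parcs G. 2)"
  proof (rule sum.cong[OF refl])
    fix e assume "e \<in> ?f ` parcs G"
    then obtain x y where xy: "(x, y) \<in> parcs G" "e = {x, y}" by auto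
    then have "{p \<in> parcs G. ?f p = e} = {(x, y), (y, x)}"
      using arcs_symmetric by (auto simp: doubleton_eq_iff)
    moreover have "x \<noteq> y" using xy no_loops' by blast
    ultimately show "card {p \<in> parcs G. ?f p = e} = 2" by simp
  qed
  finally show ?thesis by (simp add: vol_def num_edges_def)
qed

lemma stationary_eq: "stationary G u = deg G u / vol G"
  by (simp add: stationary_def out_degree_eq_deg vol_eq_num_edges)

section \<open>Harmonic functions and uniqueness of hitting times\<close>

lemma sum_nbrs_swap:
  fixes f :: "'a \<Rightarrow> 'a \<Rightarrow> real"
  shows "(\<Sum>u\<in>pverts G. \<Sum>x\<in>nbrs G u. f u x) = (\<Sum>u\<in>pverts G. \<Sum>x\<in>nbrs G u. f x u)"
proof -
  have n: "nbrs G u = {x \<in> pverts G. (u, x) \<in> parcs G}"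
    "nbrs G u = {x \<in> pverts G. (x, u) \<in> parcs G}" for u
    using nbrs_subset arcs_symmetric by auto
  have "(\<Sum>u\<in>pverts G. \<Sum>x\<in>nbrs G u. f u x) =
      (\<Sum>u\<in>pverts G. \<Sum>x | x \<in> pverts G \<and> (u, x) \<in> parcs G. f u x)"
    by (simp only: n(1))
  also have "\<dots> = (\<Sum>x\<in>pverts G. \<Sum>u | u \<in> pverts G \<and> (u, x) \<in> parcs G. f u x)"
    using pair_finite_verts by (rule sum.swap_restrict[OF _ pair_finite_verts])
  finally show ?thesis by (simp only: n(2))
qed

text \<open>Maximum principle: where the maximum is attained off \<open>w\<close>, the nonnegative
  differences to the neighbours sum to zero, so all neighbours attain it too. Following a path
  carries the maximum to \<open>w\<close>.\<close>

lemma harmonic_le: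
  assumes harm: "\<And>u. u \<in> pverts G \<Longrightarrow> u \<noteq> w \<Longrightarrow> (\<Sum>x\<in>nbrs G u. f u - f x) = (0::real)"
    and "w \<in> pverts G" and "u \<in> pverts G"
  shows "f u \<le> f w"
proof -
  define M where "M = Max (f ` pverts G)"
  have le: "f x \<le> M" if "x \<in> pverts G" for x
    using that pair_finite_verts by (simp add: M_def)
  have "M \<in> f ` pverts G"
    unfolding M_def using pair_finite_verts assms(3) by (intro Max_in) auto
  then obtain z where z: "z \<in> pverts G" "f z = M" by auto
  have "(z, w) \<in> (parcs G)\<^sup>*" using reach z assms(2) by blast
  then have "z \<in> pverts G \<longrightarrow> f z = M \<longrightarrow> f w = M"
  proof (induction rule: converse_rtrancl_induct)
    case (step y z)
    show ?case
    proof (intro impI)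
      assume y: "y \<in> pverts G" "f y = M"
      show "f w = M"
      proof (cases "y = w")
        case False
        have "(\<Sum>x\<in>nbrs G y. f y - f x) = 0" using harm y False by blast
        then have "\<forall>x\<in>nbrs G y. f y - f x = 0"
          using le nbrs_subset y(2)
          by (subst (asm) sum_nonneg_eq_0_iff) (auto intro: finite_nbrs)
        then have "f z = M" using step.hyps y by auto
        then show ?thesis using step in_arcsD2 by blast
      qed (use y in simp)
    qed
  qed simp
  then show ?thesis using z le assms(3) by simp
qed

lemma harmonic_const:
  assumes harm: "\<And>u. u \<in> pverts G \<Longrightarrow> u \<noteq> w \<Longrightarrow> (\<Sum>x\<in>nbrs G u. f u - f x) = (0::real)"
    and "w \<in> pverts G" and "u \<in> pverts G"
  shows "f u = f w"
proof (rule antisym)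
  show "f u \<le> f w" using assms by (rule harmonic_le)
  have "(\<Sum>x\<in>nbrs G z. - f z - - f x) = 0" if "z \<in> pverts G" "z \<noteq> w" for z
    using harm[OF that] by (simp add: sum_subtractf)
  then have "- f u \<le> - f w" using assms(2,3) by (rule harmonic_le)
  then show "f w \<le> f u" by simp
qed

text \<open>The difference of two solutions is harmonic off \<open>w\<close> and vanishes at
  \<open>w\<close>.\<close>

lemma hitting_unique:
  assumes "hitting G w h" and "hitting G w k" and "w \<in> pverts G" and "u \<in> pverts G"
  shows "h u = k u"
proof -
  have "(\<Sum>x\<in>nbrs G z. (h z - k z) - (h x - k x)) = 0" if "z \<in> pverts G" "z \<noteq> w" for z
  proof -
    have "(\<Sum>x\<in>nbrs G z. (h z - k z) - (h x - k x)) =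
        (\<Sum>x\<in>nbrs G z. h z - h x) - (\<Sum>x\<in>nbrs G z. k z - k x)"
      unfolding sum_subtractf[symmetric] by (intro sum.cong) auto
    then show ?thesis using hittingD(2)[OF _ that] assms(1,2) by simp
  qed
  then have "h u - k u = h w - k w" using assms(3,4) by (rule harmonic_const)
  then show ?thesis using assms(1,2) by (simp add: hitting_def)
qed

text \<open>Reversing arcs shows that the differences sum to zero over the whole graph; the
  equations off \<open>w\<close> then fix the contribution of \<open>w\<close>. Equivalently, the
  mean return time to \<open>w\<close> is \<open>vol G / deg G w\<close>.\<close>

lemma hitting_return:
  assumes "hitting G w h" and "w \<in> pverts G"
  shows "(\<Sum>x\<in>nbrs G w. h x) = vol G - deg G w"
proof -
  have "(\<Sum>u\<in>pverts G. \<Sum>x\<in>nbrs G u. h u - h x) = 0"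
    using sum_nbrs_swap[of "\<lambda>u x. h u"] by (simp add: sum_subtractf)
  moreover have "(\<Sum>u\<in>pverts G. \<Sum>x\<in>nbrs G u. h u - h x) =
      (\<Sum>x\<in>nbrs G w. h w - h x) + (\<Sum>u\<in>pverts G - {w}. \<Sum>x\<in>nbrs G u. h u - h x)"
    using pair_finite_verts assms(2) by (rule sum.remove)
  moreover have "(\<Sum>u\<in>pverts G - {w}. \<Sum>x\<in>nbrs G u. h u - h x) = (\<Sum>u\<in>pverts G - {w}. deg G u)"
    by (intro sum.cong refl hittingD(2)[OF assms(1)]) auto
  moreover have "vol G = deg G w + (\<Sum>u\<in>pverts G - {w}. deg G u)"
    unfolding vol_eq_sum_deg using pair_finite_verts assms(2) by (rule sum.remove)
  ultimately show ?thesis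
    using hittingD(1)[OF assms(1)] by (simp add: sum_negf)
qed

section \<open>Convergence of the first passage series\<close>

text \<open>
  With \<open>d\<close> the distance to \<open>w\<close> and \<open>D\<close> a bound on the degrees, the function
  \<open>1 - (1 / 2D)\<^sup>d\<close> is strictly superharmonic off \<open>w\<close>, because a vertex at distance \<open>d\<close> has a
  neighbour at distance \<open>d - 1\<close>.
\<close>

lemma ex_hitting_supersolution:
  assumes w: "w \<in> pverts G"
  shows "\<exists>h. (\<forall>u\<in>pverts G. h u \<ge> 0) \<and>
    (\<forall>u\<in>pverts G - {w}. (\<Sum>x\<in>nbrs G u. h u - h x) \<ge> deg G u)"
proof -
  define d where "d u = (LEAST n. (u, w) \<in> parcs G ^^ n)" for u
  define D where "D = real (card (pverts G))"
  \<comment> \<open>The factor 2 yields two copies of \<open>D * \<epsilon> ^ d u\<close>: one pays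
    for \<open>deg G u * \<epsilon> ^ d u\<close>, the other for the excess
    \<open>deg G u * \<epsilon> ^ N\<close>.\<close>
  define \<epsilon> where "\<epsilon> = 1 / (2 * D)"
  define N where "N = Max (d ` pverts G)"
  \<comment> \<open>The excess is at least \<open>deg G u * \<epsilon> ^ N\<close> at every vertex
    other than \<open>w\<close>, so dividing by \<open>\<epsilon> ^ N\<close> raises it to
    \<open>deg G u\<close>.\<close>
  define h where "h u = (1 - \<epsilon> ^ d u) / \<epsilon> ^ N" for u
  have D: "D \<ge> 1" using w pair_finite_verts
    by (auto simp: D_def Suc_le_eq card_gt_0_iff)
  have \<epsilon>: "0 < \<epsilon>" "\<epsilon> \<le> 1" using D by (auto simp: \<epsilon>_def field_simps)
  have degD: "deg G u \<le> D" for u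
    using card_mono[OF pair_finite_verts nbrs_subset] by (simp add: deg_def D_def)
  have dN: "d u \<le> N" if "u \<in> pverts G" for u
    using that pair_finite_verts by (simp add: N_def)
  have step: "\<exists>x\<in>nbrs G u. Suc (d x) \<le> d u" if u: "u \<in> pverts G" "u \<noteq> w" for u
  proof -
    have "\<exists>n. (u, w) \<in> parcs G ^^ n"
      using reach[OF u(1) w] by (simp add: rtrancl_power)
    then have "(u, w) \<in> parcs G ^^ d u" unfolding d_def by (rule LeastI_ex)
    moreover obtain n where n: "d u = Suc n"
      using calculation u(2) by (cases "d u") auto
    ultimately obtain x where x: "(u, x) \<in> parcs G" "(x, w) \<in> parcs G ^^ n"
      using relpow_Suc_D2 by metis
    have "d x \<le> n" unfolding d_def using x(2) by (rule Least_le)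
    then show ?thesis using x n by auto
  qed
  have "(\<Sum>x\<in>nbrs G u. h u - h x) \<ge> deg G u" if u: "u \<in> pverts G" "u \<noteq> w" for u
  proof -
    obtain y where y: "y \<in> nbrs G u" "Suc (d y) \<le> d u" using step u by blast
    have "2 * D * \<epsilon> ^ d u = \<epsilon> ^ (d u - 1)"
      using y(2) D by (cases "d u") (auto simp: \<epsilon>_def field_simps)
    also have "\<dots> \<le> \<epsilon> ^ d y" using y(2) \<epsilon> by (intro power_decreasing) auto
    also have "\<dots> \<le> (\<Sum>x\<in>nbrs G u. \<epsilon> ^ d x)"
      using y(1) finite_nbrs \<epsilon> by (intro member_le_sum) auto
    finally have "2 * D * \<epsilon> ^ d u \<le> (\<Sum>x\<in>nbrs G u. \<epsilon> ^ d x)" .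
    moreover have "deg G u * \<epsilon> ^ d u \<le> D * \<epsilon> ^ d u"
      using degD \<epsilon> by (intro mult_right_mono) auto
    moreover have "D * \<epsilon> ^ N \<le> D * \<epsilon> ^ d u"
      using D \<epsilon> dN u(1) by (intro mult_left_mono power_decreasing) auto
    moreover have "deg G u * \<epsilon> ^ N \<le> D * \<epsilon> ^ N"
      using degD \<epsilon> by (intro mult_right_mono) auto
    ultimately have "deg G u * \<epsilon> ^ N \<le> (\<Sum>x\<in>nbrs G u. \<epsilon> ^ d x) - deg G u * \<epsilon> ^ d u"
      by linarith
    also have "\<dots> = (\<Sum>x\<in>nbrs G u. \<epsilon> ^ d x - \<epsilon> ^ d u)"
      by (simp add: sum_subtractf deg_def)
    also have "\<dots> = (\<Sum>x\<in>nbrs G u. h u - h x) * \<epsilon> ^ N"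
      using \<epsilon> by (simp add: h_def sum_distrib_right diff_divide_distrib[symmetric])
    finally show ?thesis using \<epsilon> by simp
  qed
  moreover have "h u \<ge> 0" for u
    using \<epsilon> by (simp add: h_def power_le_one)
  ultimately show ?thesis by blast
qed

lemma first_passage_prob_step:
  "u \<in> pverts G \<Longrightarrow> u \<noteq> w \<Longrightarrow>
    first_passage_prob G u w (Suc n) = (\<Sum>x\<in>nbrs G u. first_passage_prob G x w n) / deg G u"
  by (intro first_passage_prob_Suc finite_nbrs nbrs_ne)

lemma first_passage_prob_nonneg: "first_passage_prob G u w n \<ge> 0"
  by (simp add: first_passage_prob_def)

text \<open>By the recurrence, the partial sum at \<open>u\<close> is an average of shorter partial
  sums at the neighbours. This gives summability before it is known that \<open>w\<close> is reached
  almost surely.\<close>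

lemma sum_first_passage_prob_le_1:
  "u \<in> pverts G \<Longrightarrow> (\<Sum>n<N. first_passage_prob G u w n) \<le> 1"
proof (induction N arbitrary: u)
  case (Suc N)
  show ?case
  proof (cases "u = w")
    case True
    then show ?thesis
      by (simp add: sum.lessThan_Suc_shift first_passage_prob_0 first_passage_prob_self_Suc
          del: sum.lessThan_Suc)
  next
    case False
    have "(\<Sum>n<Suc N. first_passage_prob G u w n) =
        (\<Sum>n<N. (\<Sum>x\<in>nbrs G u. first_passage_prob G x w n) / deg G u)"
      using False Suc.prems
      by (simp add: sum.lessThan_Suc_shift first_passage_prob_0 first_passage_prob_step
          del: sum.lessThan_Suc)
    also have "\<dots> = (\<Sum>x\<in>nbrs G u. \<Sum>n<N. first_passage_prob G x w n) / deg G u"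
      by (simp add: sum_divide_distrib[symmetric] sum.swap[of _ "{..<N}"])
    also have "\<dots> \<le> (\<Sum>x\<in>nbrs G u. 1) / deg G u"
      using Suc.IH nbrs_subset deg_pos[OF Suc.prems]
      by (intro divide_right_mono sum_mono) auto
    also have "\<dots> = 1" using deg_pos[OF Suc.prems] by (auto simp: deg_def)
    finally show ?thesis .
  qed
qed simp

lemma summable_first_passage_prob: "u \<in> pverts G \<Longrightarrow> summable (first_passage_prob G u w)"
  using first_passage_prob_nonneg sum_first_passage_prob_le_1
  by (rule summableI_nonneg_bounded)

text \<open>A supersolution dominates all truncated expectations, by induction on the truncation: a
  step costs at most 1, since the truncated law has mass at most 1, and the neighbours are covered
  by the induction hypothesis.\<close>

lemma sum_times_first_passage_prob_le:
  assumes nonneg: "\<And>u. u \<in> pverts G \<Longrightarrow> h u \<ge> 0"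
    and super: "\<And>u. u \<in> pverts G \<Longrightarrow> u \<noteq> w \<Longrightarrow> (\<Sum>x\<in>nbrs G u. h u - h x) \<ge> deg G u"
  shows "u \<in> pverts G \<Longrightarrow> (\<Sum>n<N. real n * first_passage_prob G u w n) \<le> h u"
proof (induction N arbitrary: u)
  case (Suc N)
  show ?case
  proof (cases "u = w")
    case True
    then show ?thesis using nonneg Suc.prems
      by (simp add: sum.lessThan_Suc_shift first_passage_prob_self_Suc del: sum.lessThan_Suc)
  next
    case False
    let ?f = "\<lambda>x n. first_passage_prob G x w n"
    have d: "deg G u > 0" using deg_pos Suc.prems .
    \<comment> \<open>The term at 0 vanishes; in the shifted sum the weight \<open>Suc n\<close>
      splits into \<open>n\<close> and 1.\<close>
    have "(\<Sum>n<Suc N. real n * ?f u n) = (\<Sum>n<N. (\<Sum>x\<in>nbrs G u. real n * ?f x n + ?f x n) / deg G u)"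
      using False Suc.prems
      by (simp add: sum.lessThan_Suc_shift first_passage_prob_step sum.distrib
          sum_distrib_left[symmetric] algebra_simps add_divide_distrib del: sum.lessThan_Suc)
    also have "\<dots> = (\<Sum>x\<in>nbrs G u. (\<Sum>n<N. real n * ?f x n) + (\<Sum>n<N. ?f x n)) / deg G u"
      by (simp add: sum_divide_distrib[symmetric] sum.swap[of _ "{..<N}"] sum.distrib)
    also have "\<dots> \<le> (\<Sum>x\<in>nbrs G u. h x + 1) / deg G u"
      using Suc.IH sum_first_passage_prob_le_1 in_arcsD2 d
      by (intro divide_right_mono sum_mono add_mono) auto
    also have "\<dots> = ((\<Sum>x\<in>nbrs G u. h x) + deg G u) / deg G u"
      by (simp add: sum.distrib deg_def)
    also have "\<dots> \<le> deg G u * h u / deg G u"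
      using super[OF Suc.prems False] d
      by (intro divide_right_mono) (auto simp: sum_subtractf deg_def)
    also have "\<dots> = h u" using d by simp
    finally show ?thesis .
  qed
qed (simp add: nonneg)

lemma summable_times_first_passage_prob:
  assumes "w \<in> pverts G" and "u \<in> pverts G"
  shows "summable (\<lambda>n. real n * first_passage_prob G u w n)"
proof -
  obtain h where h: "\<And>u. u \<in> pverts G \<Longrightarrow> h u \<ge> 0"
    "\<And>u. u \<in> pverts G \<Longrightarrow> u \<noteq> w \<Longrightarrow> (\<Sum>x\<in>nbrs G u. h u - h x) \<ge> deg G u"
    using ex_hitting_supersolution[OF assms(1)] by (metis DiffI singletonD)
  show ?thesis
    using first_passage_prob_nonneg sum_times_first_passage_prob_le[OF h assms(2)]
    by (intro summableI_nonneg_bounded[of _ "h u"]) auto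
qed

text \<open>The probability of ever reaching \<open>w\<close> is harmonic off \<open>w\<close> and
  equals 1 at \<open>w\<close>, hence is constantly 1.\<close>

lemma suminf_first_passage_prob:
  assumes "w \<in> pverts G" and "u \<in> pverts G"
  shows "(\<Sum>n. first_passage_prob G u w n) = 1"
proof -
  let ?q = "\<lambda>u. \<Sum>n. first_passage_prob G u w n"
  have "(\<Sum>x\<in>nbrs G z. ?q z - ?q x) = 0" if z: "z \<in> pverts G" "z \<noteq> w" for z
  proof -
    have "?q z = (\<Sum>n. first_passage_prob G z w (Suc n))"
      using suminf_split_head[OF summable_first_passage_prob[OF z(1)], of w] z
      by (simp add: first_passage_prob_0)
    also have "\<dots> = (\<Sum>n. \<Sum>x\<in>nbrs G z. first_passage_prob G x w n) / deg G z"
      using z nbrs_subset by (simp add: first_passage_prob_step,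
        subst suminf_divide) (auto intro!: summable_sum summable_first_passage_prob)
    also have "\<dots> = (\<Sum>x\<in>nbrs G z. ?q x) / deg G z"
      using nbrs_subset by (subst suminf_sum) (auto intro!: summable_first_passage_prob)
    finally show ?thesis
      using deg_pos[OF z(1)] by (simp add: sum_subtractf deg_def field_simps)
  qed
  then have "?q u = ?q w" using assms by (rule harmonic_const)
  also have "?q w = (\<Sum>n\<in>{0}. first_passage_prob G w w n)"
    by (rule suminf_finite) (auto simp: gr0_conv_Suc first_passage_prob_self_Suc)
  finally show ?thesis by (simp add: first_passage_prob_0)
qed

text \<open>Apply the recurrence termwise and exchange the sums. Writing \<open>Suc n\<close> as
  \<open>n\<close> plus 1 produces the mean times of the neighbours plus the total masses, each
  equal to 1.\<close>

lemma hitting_mean_first_passage: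
  assumes w: "w \<in> pverts G"
  shows "hitting G w (\<lambda>u. mean_first_passage G u w)"
proof -
  let ?f = "\<lambda>x n. first_passage_prob G x w n" and ?m = "\<lambda>u. mean_first_passage G u w"
  have "(\<Sum>x\<in>nbrs G u. ?m u - ?m x) = deg G u" if u: "u \<in> pverts G" "u \<noteq> w" for u
  proof -
    have s: "summable (\<lambda>n. real n * ?f x n)" "summable (?f x)" "(\<Sum>n. ?f x n) = 1"
      if "x \<in> nbrs G u" for x
    proof -
      have "x \<in> pverts G" using that nbrs_subset by blast
      then show "summable (\<lambda>n. real n * ?f x n)" "summable (?f x)" "(\<Sum>n. ?f x n) = 1"
        by (rule summable_times_first_passage_prob[OF w] summable_first_passage_prob
            suminf_first_passage_prob[OF w])+
    qed
    have "?m u = (\<Sum>n. real (Suc n) * ?f u (Suc n))"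
      using suminf_split_head[OF summable_times_first_passage_prob[OF w u(1)]]
      by (simp add: mean_first_passage_def)
    also have "\<dots> = (\<Sum>n. (\<Sum>x\<in>nbrs G u. real n * ?f x n + ?f x n) / deg G u)"
      using u by (simp add: first_passage_prob_step sum.distrib sum_distrib_left[symmetric]
          algebra_simps add_divide_distrib)
    also have "\<dots> = (\<Sum>n. \<Sum>x\<in>nbrs G u. real n * ?f x n + ?f x n) / deg G u"
      by (rule suminf_divide) (auto intro!: summable_sum summable_add s)
    also have "(\<Sum>n. \<Sum>x\<in>nbrs G u. real n * ?f x n + ?f x n) =
        (\<Sum>x\<in>nbrs G u. \<Sum>n. real n * ?f x n + ?f x n)"
      by (rule suminf_sum) (auto intro!: summable_add s)
    also have "\<dots> = (\<Sum>x\<in>nbrs G u. ?m x + 1)"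
      by (intro sum.cong refl) (simp add: suminf_add[symmetric] s mean_first_passage_def)
    finally have "deg G u * ?m u = (\<Sum>x\<in>nbrs G u. ?m x + 1)"
      using deg_pos[OF u(1)] by simp
    then show ?thesis by (simp add: sum_subtractf sum.distrib deg_def)
  qed
  then show ?thesis by (auto simp: hitting_def mean_first_passage_self)
qed

lemma mean_first_passage_eqI:
  "hitting G w h \<Longrightarrow> w \<in> pverts G \<Longrightarrow> u \<in> pverts G \<Longrightarrow> mean_first_passage G u w = h u"
  by (rule hitting_unique[OF hitting_mean_first_passage])

section \<open>Kemeny's constant and the accessibility index as degree-weighted sums\<close>

text \<open>The weighted sum \<open>S u\<close> is harmonic at every vertex: the targets
  \<open>w \<noteq> u\<close> contribute \<open>(vol G - deg G u) * deg G u\<close>, and the target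
  \<open>u\<close> contributes the negative of this by \<open>hitting_return\<close>. So
  \<open>S\<close> is constant and the description in \<open>kemeny\<close> is proper.\<close>

lemma kemeny_eq_sum:
  assumes v: "v \<in> pverts G"
  shows "kemeny G * vol G = (\<Sum>w\<in>pverts G. deg G w * mean_first_passage G v w)"
proof -
  let ?m = "mean_first_passage G" and ?V = "pverts G"
  define S where "S u = (\<Sum>w\<in>?V. deg G w * ?m u w)" for u
  have harm: "(\<Sum>x\<in>nbrs G u. S u - S x) = 0" if u: "u \<in> ?V" for u
  proof -
    have "(\<Sum>x\<in>nbrs G u. S u - S x) = (\<Sum>w\<in>?V. deg G w * (\<Sum>x\<in>nbrs G u. ?m u w - ?m x w))"
      unfolding S_def sum_subtractf[symmetric] right_diff_distrib[symmetric] sum_distrib_left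
      by (rule sum.swap)
    also have "\<dots> = deg G u * (\<Sum>x\<in>nbrs G u. ?m u u - ?m x u) +
        (\<Sum>w\<in>?V - {u}. deg G w * (\<Sum>x\<in>nbrs G u. ?m u w - ?m x w))"
      using pair_finite_verts u by (rule sum.remove)
    also have "(\<Sum>x\<in>nbrs G u. ?m u u - ?m x u) = deg G u - vol G"
      using hitting_return[OF hitting_mean_first_passage[OF u] u]
      by (simp add: mean_first_passage_self sum_negf)
    also have "(\<Sum>w\<in>?V - {u}. deg G w * (\<Sum>x\<in>nbrs G u. ?m u w - ?m x w)) =
        (\<Sum>w\<in>?V - {u}. deg G w * deg G u)"
      using hittingD(2)[OF hitting_mean_first_passage] u by (intro sum.cong refl) auto
    also have "\<dots> = (vol G - deg G u) * deg G u"
      using sum.remove[OF pair_finite_verts u, of "deg G"]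
      by (simp add: sum_distrib_right vol_eq_sum_deg)
    finally show ?thesis by (simp add: algebra_simps)
  qed
  have K: "(\<Sum>w\<in>?V - {u}. stationary G w * ?m u w) = S v / vol G" if u: "u \<in> ?V" for u
  proof -
    have "(\<Sum>w\<in>?V - {u}. stationary G w * ?m u w) = S u / vol G"
      using sum.remove[OF pair_finite_verts u, of "\<lambda>w. deg G w * ?m u w"]
      by (simp add: S_def mean_first_passage_self stationary_eq sum_divide_distrib)
    also have "S u = S v" using harm v u by (intro harmonic_const) auto
    finally show ?thesis .
  qed
  \<comment> \<open>Uniqueness of the described value uses that \<open>v\<close> is a
    vertex.\<close>
  have "kemeny G = S v / vol G"
    unfolding kemeny_def using K v by (intro the_equality) auto
  then show ?thesis using vol_pos by (simp add: S_def)
qed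

lemma accessibility_index_eq_sum:
  assumes v: "v \<in> pverts G"
  shows "accessibility_index G v * vol G = (\<Sum>u\<in>pverts G. deg G u * mean_first_passage G u v)"
proof -
  have "accessibility_index G v * vol G = (\<Sum>u\<in>pverts G - {v}. deg G u * mean_first_passage G u v)"
    using vol_pos by (simp add: accessibility_index_def stationary_eq sum_distrib_right)
  then show ?thesis
    using sum.remove[OF pair_finite_verts v, of "\<lambda>u. deg G u * mean_first_passage G u v"]
    by (simp add: mean_first_passage_self)
qed

end

section \<open>Gluing two graphs at a vertex\<close>

text \<open>By symmetry it suffices that every vertex reaches one fixed vertex \<open>c\<close>: two
  such paths, one reversed, join any pair.\<close>

lemma walk_graphI:
  assumes "finite (pverts G)" and sub: "parcs G \<subseteq> pverts G \<times> pverts G"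
    and "sym (parcs G)" and "irrefl (parcs G)" and "parcs G \<noteq> {}"
    and c: "\<And>u. u \<in> pverts G \<Longrightarrow> (u, c) \<in> (parcs G)\<^sup>*"
  shows "walk_graph G"
proof
  show "finite (parcs G)" using assms(1) sub by (auto intro: finite_subset)
  show "symmetric (with_proj G)" using assms(3) by (simp add: symmetric_def)
  show "(u, w) \<in> (parcs G)\<^sup>*" if "u \<in> pverts G" "w \<in> pverts G" for u w
    using c[OF that(1)] c[OF that(2)] sym_rtrancl[OF assms(3)] by (meson rtrancl_trans symD)
qed (use assms in \<open>auto simp: irrefl_def\<close>)

lemma walk_graph_if_connected:
  assumes "pair_graph G" and "Digraph_Component.connected (with_proj G)" and "num_edges G \<ge> 1"
  shows "walk_graph G"
proof -
  interpret pair_graph G by fact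
  have sc: "strongly_connected (with_proj G)"
    using sym_arcs assms(2) by (rule symmetric_connected_imp_strongly_connected)
  show ?thesis
  proof
    show "(u, w) \<in> (parcs G)\<^sup>*" if "u \<in> pverts G" "w \<in> pverts G" for u w
    proof -
      have "reachable (with_proj G) u w"
        using sc that unfolding strongly_connected_def by simp
      then have "(u, w) \<in> (arcs_ends (with_proj G))\<^sup>*"
        unfolding reachable_def by (rule rtrancl_on_rtranclI)
      then show ?thesis by simp
    qed
    show "parcs G \<noteq> {}" using assms(3) by (auto simp: num_edges_def)
  qed
qed

lemma walk_graph_add_edges:
  assumes "walk_graph G" and F: "F \<subseteq> pverts G \<times> pverts G" "irrefl F"
  shows "walk_graph (add_edges G F)"
proof -
  interpret walk_graph G by fact
  obtain c where c: "c \<in> pverts G" using arcs_ne in_arcsD1 by auto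
  show ?thesis
  proof (rule walk_graphI[where c = c])
    show "parcs (add_edges G F) \<subseteq> pverts (add_edges G F) \<times> pverts (add_edges G F)"
      using F(1) in_arcsD1 in_arcsD2 by (auto simp: add_edges_def)
    show "irrefl (parcs (add_edges G F))"
      using F(2) no_loops' by (auto simp: add_edges_def irrefl_def)
    show "sym (parcs (add_edges G F))"
      using arcs_symmetric by (auto simp: add_edges_def intro!: symI)
    show "(u, c) \<in> (parcs (add_edges G F))\<^sup>*" if "u \<in> pverts (add_edges G F)" for u
    proof -
      have "(u, c) \<in> (parcs G)\<^sup>*" using reach c that by (simp add: add_edges_def)
      then show ?thesis by (rule rtrancl_mono[THEN subsetD, rotated]) (auto simp: add_edges_def)
    qed
  qed (use pair_finite_verts arcs_ne in \<open>auto simp: add_edges_def\<close>)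
qed

section \<open>The walk on a union with a cut vertex\<close>

locale cut_vertex_union = G: walk_graph G + S: walk_graph S for G S :: "'a pair_pre_digraph" +
  fixes v :: 'a
  assumes inter: "pverts G \<inter> pverts S = {v}"
begin

lemma cut_vertex_in: "v \<in> pverts G" "v \<in> pverts S"
  using inter by auto

lemma pverts_union: "pverts (graph_union G S) = pverts G \<union> pverts S"
  by (simp add: graph_union_def)

lemma nbrs_union: "nbrs (graph_union G S) u = nbrs G u \<union> nbrs S u"
  by (auto simp: graph_union_def)

text \<open>A common arc would have both ends equal to \<open>v\<close>, a loop. Hence sums over
  neighbours and degrees are additive over the two parts.\<close>

lemma nbrs_disjoint: "nbrs G u \<inter> nbrs S u = {}"
proof -
  have False if "(u, x) \<in> parcs G" "(u, x) \<in> parcs S" for x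
  proof -
    have "u = v" "x = v"
      using that inter G.in_arcsD1 G.in_arcsD2 S.in_arcsD1 S.in_arcsD2 by blast+
    then show False using that G.no_loops' by blast
  qed
  then show ?thesis by auto
qed

lemma sum_nbrs_union:
  "(\<Sum>x\<in>nbrs (graph_union G S) u. f x) = (\<Sum>x\<in>nbrs G u. f x) + (\<Sum>x\<in>nbrs S u. f x)"
  unfolding nbrs_union by (intro sum.union_disjoint G.finite_nbrs S.finite_nbrs nbrs_disjoint)

lemma deg_union: "deg (graph_union G S) u = deg G u + deg S u"
  unfolding deg_def nbrs_union
  using card_Un_disjoint[OF G.finite_nbrs S.finite_nbrs nbrs_disjoint] by simp

lemma nbrs_empty: "u \<notin> pverts G \<Longrightarrow> nbrs G u = {}" "u \<notin> pverts S \<Longrightarrow> nbrs S u = {}"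
  using G.in_arcsD1 S.in_arcsD1 by auto

lemma deg_eq_0: "u \<notin> pverts G \<Longrightarrow> deg G u = 0" "u \<notin> pverts S \<Longrightarrow> deg S u = 0"
  using nbrs_empty by (simp_all add: deg_def)

lemma walk_graph_union: "walk_graph (graph_union G S)"
proof (rule walk_graphI[where c = v])
  let ?H = "graph_union G S"
  show "parcs ?H \<subseteq> pverts ?H \<times> pverts ?H"
    using G.in_arcsD1 G.in_arcsD2 S.in_arcsD1 S.in_arcsD2 by (auto simp: graph_union_def)
  show "sym (parcs ?H)"
    using G.arcs_symmetric S.arcs_symmetric by (auto simp: graph_union_def intro!: symI)
  show "irrefl (parcs ?H)"
    using G.no_loops' S.no_loops' by (auto simp: graph_union_def irrefl_def)
  show "(u, v) \<in> (parcs ?H)\<^sup>*" if "u \<in> pverts ?H" for u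
  proof -
    have "(u, v) \<in> (parcs G)\<^sup>* \<union> (parcs S)\<^sup>*"
      using that G.reach S.reach cut_vertex_in by (auto simp: graph_union_def)
    then show ?thesis
      using rtrancl_mono[of "parcs G" "parcs ?H"] rtrancl_mono[of "parcs S" "parcs ?H"]
      by (auto simp: graph_union_def)
  qed
qed (use G.pair_finite_verts S.pair_finite_verts G.arcs_ne in \<open>auto simp: graph_union_def\<close>)

text \<open>
  The commute time \<open>m\<^sub>v\<^sub>w + m\<^sub>w\<^sub>v\<close> is \<open>vol G\<close> times the effective resistance between \<open>v\<close> and \<open>w\<close>,
  and attaching \<open>S\<close> adds \<open>vol S\<close> times that resistance to the mean first passage time.
\<close>

lemma mean_first_passage_union:
  assumes w: "w \<in> pverts G"
  shows "mean_first_passage (graph_union G S) v w = mean_first_passage G v w +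
    vol S / vol G * (mean_first_passage G v w + mean_first_passage G w v)"
proof -
  interpret H: walk_graph "graph_union G S" by (rule walk_graph_union)
  let ?m = "mean_first_passage G" and ?s = "mean_first_passage S"
  define r where "r = vol S / vol G"
  \<comment> \<open>From \<open>S\<close> the walk must pass \<open>v\<close> first, which gives the
    second branch. On \<open>G\<close> the factor after \<open>r\<close> is harmonic off
    \<open>v\<close> and \<open>w\<close> and vanishes at \<open>w\<close>; if
    \<open>v \<noteq> w\<close>, its differences at \<open>v\<close> sum to
    \<open>vol G\<close>.\<close>
  define h where "h u = (if u \<in> pverts G then ?m u w + r * (?m u w + ?m w v - ?m u v)
    else ?m v w + r * (?m v w + ?m w v) + ?s u v)" for u
  have hG: "h u = ?m u w + r * (?m u w + ?m w v - ?m u v)" if "u \<in> pverts G" for u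
    using that by (simp add: h_def)
  \<comment> \<open>Both branches agree at the shared vertex, because passage times from
    \<open>v\<close> to itself are 0.\<close>
  have hS: "h u = ?m v w + r * (?m v w + ?m w v) + ?s u v" if "u \<in> pverts S" for u
  proof (cases "u \<in> pverts G")
    case True
    then have "u = v" using that inter by blast
    then show ?thesis using True by (simp add: h_def mean_first_passage_self)
  qed (simp add: h_def)
  have sG: "(\<Sum>x\<in>nbrs G u. h u - h x) =
      (1 + r) * (\<Sum>x\<in>nbrs G u. ?m u w - ?m x w) - r * (\<Sum>x\<in>nbrs G u. ?m u v - ?m x v)"
    if "u \<in> pverts G" for u
    unfolding sum_distrib_left sum_subtractf[symmetric]
    using that G.in_arcsD2 by (intro sum.cong refl) (auto simp: hG algebra_simps)
  have sS: "(\<Sum>x\<in>nbrs S u. h u - h x) = (\<Sum>x\<in>nbrs S u. ?s u v - ?s x v)"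
    if "u \<in> pverts S" for u
    using that S.in_arcsD2 by (intro sum.cong refl) (auto simp: hS)
  note mw = hittingD(2)[OF G.hitting_mean_first_passage[OF w]]
    and mv = hittingD(2)[OF G.hitting_mean_first_passage[OF cut_vertex_in(1)]]
    and sv = hittingD(2)[OF S.hitting_mean_first_passage[OF cut_vertex_in(2)]]
  have "(\<Sum>x\<in>nbrs (graph_union G S) u. h u - h x) = deg (graph_union G S) u"
    if u: "u \<in> pverts (graph_union G S)" "u \<noteq> w" for u
  proof -
    consider "u = v" | "u \<in> pverts G" "u \<notin> pverts S" | "u \<in> pverts S" "u \<notin> pverts G"
      using u(1) inter by (auto simp: pverts_union)
    then show ?thesis
    proof cases
      case 1
      \<comment> \<open>At \<open>v\<close> the part \<open>S\<close> falls short of its degree by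
        \<open>vol S\<close>; the factor \<open>r\<close> is chosen so that the surplus
        \<open>r * vol G\<close> from \<open>G\<close> makes up for it.\<close>
      have "(\<Sum>x\<in>nbrs G v. ?m v v - ?m x v) = deg G v - vol G"
        using G.hitting_return[OF G.hitting_mean_first_passage] cut_vertex_in
        by (simp add: mean_first_passage_self sum_negf)
      moreover have "(\<Sum>x\<in>nbrs S v. ?s v v - ?s x v) = deg S v - vol S"
        using S.hitting_return[OF S.hitting_mean_first_passage] cut_vertex_in
        by (simp add: mean_first_passage_self sum_negf)
      moreover have "r * (deg G v - vol G) = r * deg G v - vol S"
        using G.vol_pos by (simp add: r_def algebra_simps)
      ultimately show ?thesis
        using 1 u(2) cut_vertex_in
        by (simp add: sum_nbrs_union deg_union sG sS mw distrib_right)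
    next
      case 2
      then have "u \<noteq> v" using cut_vertex_in(2) by blast
      then show ?thesis
        using 2 u(2) nbrs_empty(2)[of u] mv[of u]
        by (simp add: sum_nbrs_union deg_union deg_eq_0 sG mw algebra_simps)
    next
      case 3
      then show ?thesis
        using cut_vertex_in(1) nbrs_empty(1)[of u] sv[of u]
        by (auto simp: sum_nbrs_union deg_union deg_eq_0 sS)
    qed
  qed
  then have "hitting (graph_union G S) w h"
    using w by (auto simp: hitting_def hG mean_first_passage_self)
  then have "mean_first_passage (graph_union G S) v w = h v"
    using w cut_vertex_in by (intro H.mean_first_passage_eqI) (auto simp: pverts_union)
  then show ?thesis
    using cut_vertex_in by (simp add: hG r_def mean_first_passage_self)
qed

text \<open>Weighting by the degrees in \<open>G\<close> alone turns passages from \<open>v\<close>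
  into Kemeny's constant of \<open>G\<close> and passages to \<open>v\<close> into the accessibility
  index. The other half of the degrees is handled by exchanging the parts.\<close>

lemma sum_deg_mean_first_passage_union:
  "(\<Sum>w\<in>pverts G. deg G w * mean_first_passage (graph_union G S) v w) =
    vol G * kemeny G + vol S * (kemeny G + accessibility_index G v)"
proof -
  let ?m = "mean_first_passage G" and ?r = "vol S / vol G"
  have "(\<Sum>w\<in>pverts G. deg G w * mean_first_passage (graph_union G S) v w) =
      (\<Sum>w\<in>pverts G. (1 + ?r) * (deg G w * ?m v w) + ?r * (deg G w * ?m w v))"
    by (intro sum.cong refl) (simp add: mean_first_passage_union algebra_simps)
  also have "\<dots> = (1 + ?r) * (kemeny G * vol G) + ?r * (accessibility_index G v * vol G)"
    unfolding sum.distrib sum_distrib_left[symmetric]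
    using cut_vertex_in by (simp only: G.kemeny_eq_sum G.accessibility_index_eq_sum)
  also have "\<dots> = vol G * kemeny G + vol S * (kemeny G + accessibility_index G v)"
    using G.vol_pos by (simp add: field_simps)
  finally show ?thesis .
qed

end

lemma graph_union_commute: "graph_union G S = graph_union S G"
  by (simp add: graph_union_def Un_commute)

text \<open>Take \<open>v\<close> as start vertex. Degrees add, so the sum splits into one for each
  part, and dividing by the total volume isolates the two Kemeny constants.\<close>

lemma kemeny_graph_union:
  assumes "walk_graph G" and "walk_graph S" and inter: "pverts G \<inter> pverts S = {v}"
  shows "kemeny (graph_union G S) = kemeny G + kemeny S +
    (vol S * accessibility_index G v + vol G * accessibility_index S v) / (vol G + vol S)"
proof -
  interpret U: cut_vertex_union G S v
    using assms by (simp add: cut_vertex_union_def cut_vertex_union_axioms_def)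
  interpret U': cut_vertex_union S G v
    using assms by (simp add: cut_vertex_union_def cut_vertex_union_axioms_def Int_commute)
  let ?H = "graph_union G S"
  interpret H: walk_graph ?H by (rule U.walk_graph_union)
  \<comment> \<open>Degrees of a part vanish outside it, so its sums may range over either vertex
    set.\<close>
  have ext: "(\<Sum>w\<in>pverts ?H. deg X w * f w) = (\<Sum>w\<in>pverts X. deg X w * f w)"
    if "X = G \<or> X = S" for X and f :: "_ \<Rightarrow> real"
    using that U.deg_eq_0 H.pair_finite_verts
    by (intro sum.mono_neutral_right) (auto simp: U.pverts_union)
  have vol: "vol ?H = vol G + vol S"
    using ext[of G "\<lambda>_. 1"] ext[of S "\<lambda>_. 1"]
    by (simp add: H.vol_eq_sum_deg U.G.vol_eq_sum_deg U.S.vol_eq_sum_deg U.deg_union sum.distrib)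
  have "kemeny ?H * vol ?H = (\<Sum>w\<in>pverts ?H. deg ?H w * mean_first_passage ?H v w)"
    using U.cut_vertex_in by (intro H.kemeny_eq_sum) (simp add: U.pverts_union)
  also have "\<dots> = (\<Sum>w\<in>pverts G. deg G w * mean_first_passage ?H v w) +
      (\<Sum>w\<in>pverts S. deg S w * mean_first_passage ?H v w)"
    by (simp add: U.deg_union distrib_right sum.distrib ext)
  also have "\<dots> = (vol G * kemeny G + vol S * (kemeny G + accessibility_index G v)) +
      (vol S * kemeny S + vol G * (kemeny S + accessibility_index S v))"
    using U.sum_deg_mean_first_passage_union U'.sum_deg_mean_first_passage_union
    by (simp add: graph_union_commute[of S G])
  finally show ?thesis
    using U.G.vol_pos U.S.vol_pos by (simp add: vol field_simps)
qed

section \<open>The spider with added edges\<close>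

text \<open>Added edges join neighbours of the center, not pendent vertices. By symmetry of the legs
  the pair \<open>a1\<close>, \<open>a2\<close> represents all three.\<close>

definition spider_edge ::
  "'a \<Rightarrow> 'a \<Rightarrow> 'a \<Rightarrow> 'a \<Rightarrow> 'a \<Rightarrow> 'a \<Rightarrow> 'a \<Rightarrow> 'a pair_pre_digraph" where
  "spider_edge c a1 b1 a2 b2 a3 b3 = add_edges (spider23 c a1 b1 a2 b2 a3 b3) {(a1, a2)}"

definition spider_triangle ::
  "'a \<Rightarrow> 'a \<Rightarrow> 'a \<Rightarrow> 'a \<Rightarrow> 'a \<Rightarrow> 'a \<Rightarrow> 'a \<Rightarrow> 'a pair_pre_digraph" where
  "spider_triangle c a1 b1 a2 b2 a3 b3 = add_edges (spider23 c a1 b1 a2 b2 a3 b3)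
    {(a1, a2), (a1, a3), (a2, a3)}"

text \<open>With \<open>Image_insert_Pair\<close>, this lets the simplifier evaluate neighbour sets
  of explicitly listed arcs.\<close>

lemma converse_insert_Pair: "(insert (x, y) r)\<inverse> = insert (y, x) (r\<inverse>)"
  by auto

lemma Image_insert_Pair:
  "insert (x, y) r `` {u} = (if x = u then insert y (r `` {u}) else r `` {u})"
  by auto

lemmas spider_simps = spider23_def spider_edge_def spider_triangle_def add_edges_def
  converse_insert_Pair Image_insert_Pair Un_Image insert_commute

lemma pverts_spider:
  "pverts (spider23 c a1 b1 a2 b2 a3 b3) = {c, a1, b1, a2, b2, a3, b3}"
  "pverts (spider_edge c a1 b1 a2 b2 a3 b3) = {c, a1, b1, a2, b2, a3, b3}"
  "pverts (spider_triangle c a1 b1 a2 b2 a3 b3) = {c, a1, b1, a2, b2, a3, b3}"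
  by (simp_all add: spider23_def spider_edge_def spider_triangle_def add_edges_def)

text \<open>Permuting legs transfers values computed for one leg to the others; the extra edge
  leaves only the exchange of the first two legs.\<close>

lemma spider_swap:
  "spider23 c a1 b1 a2 b2 a3 b3 = spider23 c a2 b2 a1 b1 a3 b3"
  "spider23 c a1 b1 a2 b2 a3 b3 = spider23 c a3 b3 a2 b2 a1 b1"
  "spider_edge c a1 b1 a2 b2 a3 b3 = spider_edge c a2 b2 a1 b1 a3 b3"
  "spider_triangle c a1 b1 a2 b2 a3 b3 = spider_triangle c a2 b2 a1 b1 a3 b3"
  "spider_triangle c a1 b1 a2 b2 a3 b3 = spider_triangle c a3 b3 a2 b2 a1 b1"
  by (simp_all add: spider_simps)

context
  fixes c a1 b1 a2 b2 a3 b3 :: 'a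
  assumes dist: "distinct [c, a1, b1, a2, b2, a3, b3]"
begin

lemma spider_vertices_neq:
  shows "c \<noteq> a1" "c \<noteq> b1" "c \<noteq> a2" "c \<noteq> b2" "c \<noteq> a3" "c \<noteq> b3"
    and "a1 \<noteq> b1" "a1 \<noteq> a2" "a1 \<noteq> b2" "a1 \<noteq> a3" "a1 \<noteq> b3"
    and "b1 \<noteq> a2" "b1 \<noteq> b2" "b1 \<noteq> a3" "b1 \<noteq> b3"
    and "a2 \<noteq> b2" "a2 \<noteq> a3" "a2 \<noteq> b3"
    and "b2 \<noteq> a3" "b2 \<noteq> b3"
    and "a3 \<noteq> b3"
  using dist by simp_all

lemmas spider_neq = spider_vertices_neq spider_vertices_neq[symmetric]

lemma walk_graph_spider: "walk_graph (spider23 c a1 b1 a2 b2 a3 b3)"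
proof (rule walk_graphI[where c = c])
  let ?S = "spider23 c a1 b1 a2 b2 a3 b3"
  have arcs: "{(a1, c), (a2, c), (a3, c), (b1, a1), (b2, a2), (b3, a3)} \<subseteq> parcs ?S"
    by (simp add: spider_simps)
  show "(u, c) \<in> (parcs ?S)\<^sup>*" if "u \<in> pverts ?S" for u
    using that arcs by (auto simp: pverts_spider intro: converse_rtrancl_into_rtrancl r_into_rtrancl)
  show "irrefl (parcs ?S)"
    by (auto simp: spider_simps irrefl_def spider_neq)
  show "sym (parcs ?S)"
    unfolding spider23_def add_edges_def
    by (simp only: pair_pre_digraph.simps Un_empty_left sym_Un_converse)
qed (simp_all add: spider_simps)

lemma walk_graph_spider_edge: "walk_graph (spider_edge c a1 b1 a2 b2 a3 b3)"
  unfolding spider_edge_def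
  by (intro walk_graph_add_edges walk_graph_spider)
    (auto simp: pverts_spider irrefl_def spider_neq)

lemma walk_graph_spider_triangle: "walk_graph (spider_triangle c a1 b1 a2 b2 a3 b3)"
  unfolding spider_triangle_def
  by (intro walk_graph_add_edges walk_graph_spider)
    (auto simp: pverts_spider irrefl_def spider_neq)

lemma nbrs_spider:
  defines "S \<equiv> spider23 c a1 b1 a2 b2 a3 b3"
  shows "nbrs S c = {a1, a2, a3}"
    and "nbrs S a1 = {c, b1}" "nbrs S a2 = {c, b2}" "nbrs S a3 = {c, b3}"
    and "nbrs S b1 = {a1}" "nbrs S b2 = {a2}" "nbrs S b3 = {a3}"
  by (simp_all add: S_def spider_simps spider_neq)

lemma nbrs_spider_edge:
  defines "S \<equiv> spider_edge c a1 b1 a2 b2 a3 b3"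
  shows "nbrs S c = {a1, a2, a3}"
    and "nbrs S a1 = {c, b1, a2}" "nbrs S a2 = {c, b2, a1}" "nbrs S a3 = {c, b3}"
    and "nbrs S b1 = {a1}" "nbrs S b2 = {a2}" "nbrs S b3 = {a3}"
  by (simp_all add: S_def spider_simps spider_neq)

lemma nbrs_spider_triangle:
  defines "S \<equiv> spider_triangle c a1 b1 a2 b2 a3 b3"
  shows "nbrs S c = {a1, a2, a3}"
    and "nbrs S a1 = {c, b1, a2, a3}" "nbrs S a2 = {c, b2, a1, a3}" "nbrs S a3 = {c, b3, a1, a2}"
    and "nbrs S b1 = {a1}" "nbrs S b2 = {a2}" "nbrs S b3 = {a3}"
  by (simp_all add: S_def spider_simps spider_neq)

section \<open>Explicit hitting times in the three spiders\<close>

text \<open>In a tree, crossing an edge takes on average one plus twice the number of edges behind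
  it: 1 and 3 going inward, 9 and 11 going outward. The default value 0 belongs to the
  target.\<close>

lemma hitting_spider:
  defines "S \<equiv> spider23 c a1 b1 a2 b2 a3 b3"
  shows "hitting S c ((\<lambda>_. 0)(a1 := 3, b1 := 4, a2 := 3, b2 := 4, a3 := 3, b3 := 4))"
    and "hitting S a1 ((\<lambda>_. 0)(c := 9, b1 := 1, a2 := 12, b2 := 13, a3 := 12, b3 := 13))"
    and "hitting S b1 ((\<lambda>_. 0)(c := 20, a1 := 11, a2 := 23, b2 := 24, a3 := 23, b3 := 24))"
  by (simp_all add: spider_neq S_def hitting_def deg_def pverts_spider nbrs_spider insert_Diff_if)

text \<open>The same count holds for bridges, giving 11 for \<open>c\<close> to \<open>a3\<close>
  and 13 for a step to a pendent vertex; values inside the triangle on \<open>c\<close>,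
  \<open>a1\<close>, \<open>a2\<close> solve the first-step equations.\<close>

lemma hitting_spider_edge:
  defines "S \<equiv> spider_edge c a1 b1 a2 b2 a3 b3"
  shows "hitting S c ((\<lambda>_. 0)(a1 := 4, b1 := 5, a2 := 4, b2 := 5, a3 := 3, b3 := 4))"
    and "hitting S a1
      ((\<lambda>_. 0)(c := 16/3, b1 := 1, a2 := 14/3, b2 := 17/3, a3 := 25/3, b3 := 28/3))"
    and "hitting S b1
      ((\<lambda>_. 0)(c := 55/3, a1 := 13, a2 := 53/3, b2 := 56/3, a3 := 64/3, b3 := 67/3))"
    and "hitting S a3 ((\<lambda>_. 0)(c := 11, a1 := 15, b1 := 16, a2 := 15, b2 := 16, b3 := 1))"
    and "hitting S b3 ((\<lambda>_. 0)(c := 24, a1 := 28, b1 := 29, a2 := 28, b2 := 29, a3 := 13))"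
  by (simp_all add: spider_neq S_def hitting_def deg_def pverts_spider nbrs_spider_edge insert_Diff_if)

text \<open>Here \<open>c\<close>, \<open>a1\<close>, \<open>a2\<close>, \<open>a3\<close> form a
  complete graph, and reaching \<open>b1\<close> from \<open>a1\<close> takes 17 steps on average,
  with 8 edges behind.\<close>

lemma hitting_spider_triangle:
  defines "S \<equiv> spider_triangle c a1 b1 a2 b2 a3 b3"
  shows "hitting S c ((\<lambda>_. 0)(a1 := 5, b1 := 6, a2 := 5, b2 := 6, a3 := 5, b3 := 6))"
    and "hitting S a1
      ((\<lambda>_. 0)(c := 4, b1 := 1, a2 := 9/2, b2 := 11/2, a3 := 9/2, b3 := 11/2))"
    and "hitting S b1
      ((\<lambda>_. 0)(c := 21, a1 := 17, a2 := 43/2, b2 := 45/2, a3 := 43/2, b3 := 45/2))"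
  by (simp_all add: spider_neq S_def hitting_def deg_def pverts_spider nbrs_spider_triangle insert_Diff_if)

text \<open>Passages from and to the center are what Kemeny's sum started at \<open>c\<close> and
  the accessibility index of \<open>c\<close> involve.\<close>

lemma mean_first_passage_spider:
  defines "S \<equiv> spider23 c a1 b1 a2 b2 a3 b3"
  shows "mean_first_passage S c a1 = 9" and "mean_first_passage S c b1 = 20"
    and "mean_first_passage S a1 c = 3" and "mean_first_passage S b1 c = 4"
  by (simp_all add: spider_neq S_def pverts_spider
      walk_graph.mean_first_passage_eqI[OF walk_graph_spider hitting_spider(1)]
      walk_graph.mean_first_passage_eqI[OF walk_graph_spider hitting_spider(2)]
      walk_graph.mean_first_passage_eqI[OF walk_graph_spider hitting_spider(3)])

lemma mean_first_passage_spider_edge: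
  defines "S \<equiv> spider_edge c a1 b1 a2 b2 a3 b3"
  shows "mean_first_passage S c a1 = 16/3" and "mean_first_passage S c b1 = 55/3"
    and "mean_first_passage S c a3 = 11" and "mean_first_passage S c b3 = 24"
    and "mean_first_passage S a1 c = 4" and "mean_first_passage S b1 c = 5"
    and "mean_first_passage S a3 c = 3" and "mean_first_passage S b3 c = 4"
  by (simp_all add: spider_neq S_def pverts_spider
      walk_graph.mean_first_passage_eqI[OF walk_graph_spider_edge hitting_spider_edge(1)]
      walk_graph.mean_first_passage_eqI[OF walk_graph_spider_edge hitting_spider_edge(2)]
      walk_graph.mean_first_passage_eqI[OF walk_graph_spider_edge hitting_spider_edge(3)]
      walk_graph.mean_first_passage_eqI[OF walk_graph_spider_edge hitting_spider_edge(4)]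
      walk_graph.mean_first_passage_eqI[OF walk_graph_spider_edge hitting_spider_edge(5)])

lemma mean_first_passage_spider_triangle:
  defines "S \<equiv> spider_triangle c a1 b1 a2 b2 a3 b3"
  shows "mean_first_passage S c a1 = 4" and "mean_first_passage S c b1 = 21"
    and "mean_first_passage S a1 c = 5" and "mean_first_passage S b1 c = 6"
  by (simp_all add: spider_neq S_def pverts_spider
      walk_graph.mean_first_passage_eqI[OF walk_graph_spider_triangle hitting_spider_triangle(1)]
      walk_graph.mean_first_passage_eqI[OF walk_graph_spider_triangle hitting_spider_triangle(2)]
      walk_graph.mean_first_passage_eqI[OF walk_graph_spider_triangle hitting_spider_triangle(3)])

end

section \<open>Volume, Kemeny's constant and accessibility index of the spiders\<close>

context
  fixes c a1 b1 a2 b2 a3 b3 :: 'a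
  assumes dist: "distinct [c, a1, b1, a2, b2, a3, b3]"
begin

text \<open>Reopening the context makes the passage times available for permuted legs, so the values
  for one leg serve all three.\<close>

lemma spider_parameters:
  defines "S \<equiv> spider23 c a1 b1 a2 b2 a3 b3"
  shows "vol S = 12" and "kemeny S = 19/2" and "accessibility_index S c = 5/2"
proof -
  interpret walk_graph S unfolding S_def using dist by (rule walk_graph_spider)
  have d: "deg S c = 3" "deg S a1 = 2" "deg S a2 = 2" "deg S a3 = 2"
    "deg S b1 = 1" "deg S b2 = 1" "deg S b3 = 1"
    by (simp_all add: spider_neq[OF dist] deg_def S_def nbrs_spider[OF dist])
  note V = pverts_spider(1)[of c a1 b1 a2 b2 a3 b3, folded S_def]
  show vol: "vol S = 12" by (simp add: spider_neq[OF dist] vol_eq_sum_deg V d)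
  have "distinct [c, a2, b2, a1, b1, a3, b3]" "distinct [c, a3, b3, a2, b2, a1, b1]"
    using dist by auto
  \<comment> \<open>The passage times are instantiated with both permuted leg orders; folding with
    \<open>spider_swap\<close> turns the permuted spiders back into \<open>S\<close>.\<close>
  note m = mean_first_passage_self mean_first_passage_spider[OF dist, folded S_def]
    this[THEN mean_first_passage_spider(1)] this[THEN mean_first_passage_spider(2)]
    this[THEN mean_first_passage_spider(3)] this[THEN mean_first_passage_spider(4)]
  note m = m[folded spider_swap(1,2)[of c a1 b1 a2 b2 a3 b3], folded S_def]
  show "kemeny S = 19/2" "accessibility_index S c = 5/2"
    using kemeny_eq_sum[of c] accessibility_index_eq_sum[of c]
    by (simp_all add: spider_neq[OF dist] V d m vol)
qed

lemma spider_edge_parameters: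
  defines "S \<equiv> spider_edge c a1 b1 a2 b2 a3 b3"
  shows "vol S = 14" and "kemeny S = 172/21" and "accessibility_index S c = 22/7"
proof -
  interpret walk_graph S unfolding S_def using dist by (rule walk_graph_spider_edge)
  have d: "deg S c = 3" "deg S a1 = 3" "deg S a2 = 3" "deg S a3 = 2"
    "deg S b1 = 1" "deg S b2 = 1" "deg S b3 = 1"
    by (simp_all add: spider_neq[OF dist] deg_def S_def nbrs_spider_edge[OF dist])
  note V = pverts_spider(2)[of c a1 b1 a2 b2 a3 b3, folded S_def]
  show vol: "vol S = 14" by (simp add: spider_neq[OF dist] vol_eq_sum_deg V d)
  have "distinct [c, a2, b2, a1, b1, a3, b3]" using dist by auto
  note m = mean_first_passage_self mean_first_passage_spider_edge[OF dist, folded S_def]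
    mean_first_passage_spider_edge[OF this,
      folded spider_swap(3)[of c a1 b1 a2 b2 a3 b3], folded S_def]
  show "kemeny S = 172/21" "accessibility_index S c = 22/7"
    using kemeny_eq_sum[of c] accessibility_index_eq_sum[of c]
    by (simp_all add: spider_neq[OF dist] V d m vol)
qed

lemma spider_triangle_parameters:
  defines "S \<equiv> spider_triangle c a1 b1 a2 b2 a3 b3"
  shows "vol S = 18" and "kemeny S = 37/6" and "accessibility_index S c = 13/3"
proof -
  interpret walk_graph S unfolding S_def using dist by (rule walk_graph_spider_triangle)
  have d: "deg S c = 3" "deg S a1 = 4" "deg S a2 = 4" "deg S a3 = 4"
    "deg S b1 = 1" "deg S b2 = 1" "deg S b3 = 1"
    by (simp_all add: spider_neq[OF dist] deg_def S_def nbrs_spider_triangle[OF dist])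
  note V = pverts_spider(3)[of c a1 b1 a2 b2 a3 b3, folded S_def]
  show vol: "vol S = 18" by (simp add: spider_neq[OF dist] vol_eq_sum_deg V d)
  have "distinct [c, a2, b2, a1, b1, a3, b3]" "distinct [c, a3, b3, a2, b2, a1, b1]"
    using dist by auto
  note m = mean_first_passage_self mean_first_passage_spider_triangle[OF dist, folded S_def]
    this[THEN mean_first_passage_spider_triangle(1)] this[THEN mean_first_passage_spider_triangle(2)]
    this[THEN mean_first_passage_spider_triangle(3)] this[THEN mean_first_passage_spider_triangle(4)]
  note m = m[folded spider_swap(4,5)[of c a1 b1 a2 b2 a3 b3], folded S_def]
  show "kemeny S = 37/6" "accessibility_index S c = 13/3"
    using kemeny_eq_sum[of c] accessibility_index_eq_sum[of c]
    by (simp_all add: spider_neq[OF dist] V d m vol)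
qed

section \<open>Comparison of Kemeny's constants after gluing\<close>

context
  fixes G :: "'a pair_pre_digraph"
  assumes walk_graph_G: "walk_graph G"
    and inter: "pverts G \<inter> {c, a1, b1, a2, b2, a3, b3} = {c}"
begin

lemma kemeny_spider:
  "kemeny (graph_union G (spider23 c a1 b1 a2 b2 a3 b3)) = kemeny G + 19/2 +
    (12 * accessibility_index G c + 5 * real (num_edges G)) / (2 * real (num_edges G) + 12)"
  using kemeny_graph_union[OF walk_graph_G walk_graph_spider[OF dist], of c] inter
  by (simp add: pverts_spider spider_parameters walk_graph.vol_eq_num_edges[OF walk_graph_G])

lemma kemeny_spider_edge:
  "kemeny (graph_union G (spider_edge c a1 b1 a2 b2 a3 b3)) = kemeny G + 172/21 +
    (14 * accessibility_index G c + 44/7 * real (num_edges G)) / (2 * real (num_edges G) + 14)"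
  using kemeny_graph_union[OF walk_graph_G walk_graph_spider_edge[OF dist], of c] inter
  by (simp add: pverts_spider spider_edge_parameters walk_graph.vol_eq_num_edges[OF walk_graph_G])

lemma kemeny_spider_triangle:
  "kemeny (graph_union G (spider_triangle c a1 b1 a2 b2 a3 b3)) = kemeny G + 37/6 +
    (18 * accessibility_index G c + 26/3 * real (num_edges G)) / (2 * real (num_edges G) + 18)"
  using kemeny_graph_union[OF walk_graph_G walk_graph_spider_triangle[OF dist], of c] inter
  by (simp add: pverts_spider spider_triangle_parameters
      walk_graph.vol_eq_num_edges[OF walk_graph_G])

text \<open>\<open>kemeny G\<close> cancels in the difference, which over a common positive
  denominator has the sign of its numerator.\<close>

lemma kemeny_spider_triangle_gt_iff:
  defines "m \<equiv> real (num_edges G)"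
  shows "kemeny (graph_union G (spider_triangle c a1 b1 a2 b2 a3 b3)) >
      kemeny (graph_union G (spider23 c a1 b1 a2 b2 a3 b3)) \<longleftrightarrow>
    3 * m ^ 2 + 93 * m + 360 < 6 * m * accessibility_index G c"
proof -
  let ?\<alpha> = "accessibility_index G c"
  have "m \<ge> 0" by (simp add: m_def)
  have "kemeny (graph_union G (spider_triangle c a1 b1 a2 b2 a3 b3)) -
      kemeny (graph_union G (spider23 c a1 b1 a2 b2 a3 b3)) =
    (6 * m * ?\<alpha> - (3 * m ^ 2 + 93 * m + 360)) / (2 * (m + 6) * (m + 9))" (is "?d = ?n / ?p")
    unfolding kemeny_spider kemeny_spider_triangle m_def[symmetric]
    using \<open>m \<ge> 0\<close> by (simp add: divide_simps) (simp add: algebra_simps power2_eq_square)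
  moreover have "?p > 0" using \<open>m \<ge> 0\<close> by simp
  ultimately have "?d > 0 \<longleftrightarrow> ?n > 0" by (simp only: zero_less_divide_iff) simp
  then show ?thesis by simp
qed

lemma kemeny_spider_edge_less_iff:
  defines "m \<equiv> real (num_edges G)"
  shows "kemeny (graph_union G (spider_edge c a1 b1 a2 b2 a3 b3)) <
      kemeny (graph_union G (spider23 c a1 b1 a2 b2 a3 b3)) \<longleftrightarrow>
    6 * m * accessibility_index G c < 4 * m ^ 2 + 94 * m + 330"
proof -
  let ?\<alpha> = "accessibility_index G c"
  have "m \<ge> 0" by (simp add: m_def)
  have "kemeny (graph_union G (spider23 c a1 b1 a2 b2 a3 b3)) -
      kemeny (graph_union G (spider_edge c a1 b1 a2 b2 a3 b3)) =
    (4 * m ^ 2 + 94 * m + 330 - 6 * m * ?\<alpha>) / (6 * (m + 6) * (m + 7))" (is "?d = ?n / ?p")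
    unfolding kemeny_spider kemeny_spider_edge m_def[symmetric]
    using \<open>m \<ge> 0\<close> by (simp add: divide_simps) (simp add: algebra_simps power2_eq_square)
  moreover have "?p > 0" using \<open>m \<ge> 0\<close> by simp
  ultimately have "?d > 0 \<longleftrightarrow> ?n > 0" by (simp only: zero_less_divide_iff) simp
  then show ?thesis by simp
qed

text \<open>Adding the edge commutes with gluing, and being a Braess edge is the negation of a
  strict decrease.\<close>

lemma braess_edge_spider_iff:
  "braess_edge (graph_union G (spider23 c a1 b1 a2 b2 a3 b3)) a1 a2 \<longleftrightarrow>
    \<not> 6 * real (num_edges G) * accessibility_index G c <
      4 * real (num_edges G) ^ 2 + 94 * real (num_edges G) + 330"
proof -
  let ?H = "graph_union G (spider23 c a1 b1 a2 b2 a3 b3)"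
  interpret walk_graph G by (rule walk_graph_G)
  have "a1 \<notin> pverts G" using inter spider_neq[OF dist] by blast
  then have "(a1, a2) \<notin> parcs G" using in_arcsD1 by blast
  moreover have "(a1, a2) \<notin> parcs (spider23 c a1 b1 a2 b2 a3 b3)"
    by (simp add: spider_simps spider_neq[OF dist])
  moreover have "add_edges ?H {(a1, a2)} = graph_union G (spider_edge c a1 b1 a2 b2 a3 b3)"
    by (simp add: graph_union_def spider_edge_def add_edges_def Un_assoc)
  ultimately show ?thesis
    using kemeny_spider_edge_less_iff
    by (auto simp: braess_edge_def graph_union_def pverts_spider spider_neq[OF dist])
qed

lemma braess_K3_spider_iff:
  "braess_K3 (graph_union G (spider23 c a1 b1 a2 b2 a3 b3)) {a1, a2, a3} \<longleftrightarrow>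
    3 * real (num_edges G) ^ 2 + 93 * real (num_edges G) + 360 <
      6 * real (num_edges G) * accessibility_index G c"
proof -
  let ?H = "graph_union G (spider23 c a1 b1 a2 b2 a3 b3)" and ?T = "{a1, a2, a3}"
  interpret walk_graph G by (rule walk_graph_G)
  have "a1 \<notin> pverts G" "a2 \<notin> pverts G" "a3 \<notin> pverts G" using inter spider_neq[OF dist] by blast+
  then have "(x, y) \<notin> parcs ?H" if "x \<in> ?T" "y \<in> ?T" for x y
    using that in_arcsD1 by (auto simp: graph_union_def spider_simps spider_neq[OF dist])
  moreover have "?T \<subseteq> pverts ?H" by (auto simp: graph_union_def pverts_spider)
  moreover have "card ?T = 3" using dist by simp
  \<comment> \<open>The triangle is given here by all six ordered pairs, in
    \<open>spider_triangle\<close> by three; closing under converse yields the same arcs.\<close>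
  moreover have "add_edges ?H {(x, y). x \<in> ?T \<and> y \<in> ?T \<and> x \<noteq> y} =
      graph_union G (spider_triangle c a1 b1 a2 b2 a3 b3)"
  proof -
    have "{(x, y). x \<in> ?T \<and> y \<in> ?T \<and> x \<noteq> y} =
        {(a1, a2), (a1, a3), (a2, a3), (a2, a1), (a3, a1), (a3, a2)}"
      by (auto simp: spider_neq[OF dist])
    then show ?thesis by (simp add: graph_union_def spider_simps)
  qed
  ultimately show ?thesis
    using kemeny_spider_triangle_gt_iff unfolding braess_K3_def by simp
qed

end

end

theorem theorem5p3:
  fixes G S H :: "'a pair_pre_digraph"
    and v a1 b1 a2 b2 a3 b3 :: 'a
    and m :: nat and \<alpha> :: real
  assumes "pair_graph G" and "Digraph_Component.connected (with_proj G)"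
    and "v \<in> pverts G"
    and "\<alpha> = accessibility_index G v"
    and "m = num_edges G" and "m \<ge> 1"
    and "distinct [v, a1, b1, a2, b2, a3, b3]"
    and "S = spider23 v a1 b1 a2 b2 a3 b3"
    and "pverts G \<inter> pverts S = {v}"
    and "H = graph_union G S"
  shows "braess_K3_without_braess_edges H {a1, a2, a3} \<longleftrightarrow>
    3 * real m ^ 2 + 93 * real m + 360 < 6 * real m * \<alpha> \<and>
    6 * real m * \<alpha> < 4 * real m ^ 2 + 94 * real m + 330"
proof -
  have G: "walk_graph G" using assms(1,2,5,6) by (intro walk_graph_if_connected) auto
  have inter: "pverts G \<inter> {v, a1, b1, a2, b2, a3, b3} = {v}"
    using assms(8,9) by (simp add: pverts_spider)
  define Q where "Q \<longleftrightarrow> 6 * real m * \<alpha> < 4 * real m ^ 2 + 94 * real m + 330"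
  \<comment> \<open>Stated for any naming of the legs that gives the same \<open>S\<close>, so
    permutations cover all three pairs in both orders with one condition \<open>Q\<close>.\<close>
  have edge: "braess_edge H x1 x2 \<longleftrightarrow> \<not> Q"
    if "distinct [v, x1, y1, x2, y2, x3, y3]" and "S = spider23 v x1 y1 x2 y2 x3 y3"
    for x1 y1 x2 y2 x3 y3
  proof -
    have "pverts G \<inter> {v, x1, y1, x2, y2, x3, y3} = {v}"
      using assms(9) by (simp add: that(2) pverts_spider)
    then show ?thesis
      using braess_edge_spider_iff[OF that(1) G] assms(4,5,10) that(2) by (simp add: Q_def)
  qed
  have "braess_edge H a1 a2 \<longleftrightarrow> \<not> Q" using assms(7,8) by (rule edge)
  moreover have "braess_edge H a2 a1 \<longleftrightarrow> \<not> Q"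
    by (rule edge[of a2 b2 a1 b1 a3 b3]) (simp_all add: assms(8) spider_neq[OF assms(7)] spider_simps)
  moreover have "braess_edge H a1 a3 \<longleftrightarrow> \<not> Q"
    by (rule edge[of a1 b1 a3 b3 a2 b2]) (simp_all add: assms(8) spider_neq[OF assms(7)] spider_simps)
  moreover have "braess_edge H a3 a1 \<longleftrightarrow> \<not> Q"
    by (rule edge[of a3 b3 a1 b1 a2 b2]) (simp_all add: assms(8) spider_neq[OF assms(7)] spider_simps)
  moreover have "braess_edge H a2 a3 \<longleftrightarrow> \<not> Q"
    by (rule edge[of a2 b2 a3 b3 a1 b1]) (simp_all add: assms(8) spider_neq[OF assms(7)] spider_simps)
  moreover have "braess_edge H a3 a2 \<longleftrightarrow> \<not> Q"
    by (rule edge[of a3 b3 a2 b2 a1 b1]) (simp_all add: assms(8) spider_neq[OF assms(7)] spider_simps)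
  moreover have "\<not> braess_edge H x x" for x by (simp add: braess_edge_def)
  ultimately have "(\<forall>x\<in>{a1, a2, a3}. \<forall>y\<in>{a1, a2, a3}. \<not> braess_edge H x y) \<longleftrightarrow> Q"
    by auto
  moreover have "braess_K3 H {a1, a2, a3} \<longleftrightarrow> 3 * real m ^ 2 + 93 * real m + 360 < 6 * real m * \<alpha>"
    using braess_K3_spider_iff[OF assms(7) G inter] assms(4,5,8,10) by simp
  ultimately show ?thesis
    by (simp add: braess_K3_without_braess_edges_def Q_def)
qed

end
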